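(* Let $\{A_1,\ldots,A_m\}\subset\mathbb{T}^{N\times N}$ be a finite set of tropical adjacency matrices. There exists a finite sequence $A_{i_1},\ldots,A_{i_n}$, with $1\le i_r\le m$ for all $r\in\{1,\ldots,n\}$, such that the system that at successive time steps applies the matrices of this sequence (that is, $\mathbf{x}(r)=A_{i_r}\otimes\mathbf{x}(r-1)$ for $r=1,\ldots,n$) attains consensus in $n$ time steps for all initial conditions $\mathbf{x}(0)\in\mathbb{R}^N$, if and only if $\mathcal{G}(A_1),\ldots,\mathcal{G}(A_m)$ are jointly strongly connected.
   Context: $\mathbb{T}=\{0,-\infty\}$, with tropical operations $a\oplus b=\max(a,b)$, $a\otimes b=a+b$ on $\mathbb{R}\cup\{-\infty\}$; for $\mathbf{x}\in\mathbb{R}^N$, $(A\otimes\mathbf{x})_i=\max_j\{a_{ij}+x_j\}$. A tropical adjacency matrix is a matrix in $\mathbb{T}^{N\times N}$ all of whose diagonal entries are $0$. Its dependency graph $\mathcal{G}(A)$ is the directed graph with node set $\mathcal{V}=\{1,\ldots,N\}$ in which $(i,j)$ is an edge exactly when $(A)_{ji}=0$; its edge set is $\mathcal{E}(A)$. A graph with $N$ nodes is strongly connected if for every pair of nodes $i,j$ there is a sequence of nodes $i=i_0,i_1,\ldots,i_s=j$ with $s\le N-1$ and each $(i_{l-1},i_l)$, $l\in\{1,\ldots,s\}$, an edge. The graphs $\mathcal{G}(A_1),\ldots,\mathcal{G}(A_m)$ are jointly strongly connected if the union graph $(\mathcal{V},\bigcup_{r=1}^m\mathcal{E}(A_r))=\mathcal{G}(A_1\oplus\cdots\oplus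 A_m)$ is strongly connected, where $\oplus$ of matrices is the entrywise maximum. Attaining consensus in $n$ time steps from $\mathbf{x}(0)$ means $x_i(n)=\max_{j\in\mathcal{V}}\{x_j(0)\}$ for all $i\in\mathcal{V}$. *)

theory Defs
  imports "HOL-Analysis.Analysis"
begin

text \<open>
  The max-plus semiring on \<open>\<real> \<union> {-\<infinity>}\<close> is the part of \<^typ>\<open>ereal\<close> without \<open>\<infinity>\<close>:
  \<open>\<oplus>\<close> is \<^const>\<open>max\<close> and \<open>\<otimes>\<close> is \<open>+\<close>. The nodes \<open>1, ..., N\<close> are the elements of a
  finite type \<open>'n\<close>, so \<open>N = CARD('n)\<close>.
\<close>

definition trop_adjacency :: "ereal^'n^'n \<Rightarrow> bool" where
  "trop_adjacency A \<longleftrightarrow> (\<forall>i j. A $ i $ j \<in> {0, -\<infinity>}) \<and> (\<forall>i. A $ i $ i = 0)"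

definition trop_mult_vec :: "ereal^'n^'n \<Rightarrow> ereal^'n \<Rightarrow> ereal^'n" (infixr "\<otimes>\<^sub>v" 75) where
  "A \<otimes>\<^sub>v x = (\<chi> i. MAX j. A $ i $ j + x $ j)"

text \<open>The dependency graph has node set \<^term>\<open>UNIV :: 'n set\<close>; note the transposed indices.\<close>

definition dep_edges :: "ereal^'n^'n \<Rightarrow> ('n \<times> 'n) set" where
  "dep_edges A = {(i, j). A $ j $ i = 0}"

definition strongly_conn :: "'v set \<Rightarrow> ('v \<times> 'v) set \<Rightarrow> bool" where
  "strongly_conn V E \<longleftrightarrow>
    (\<forall>i\<in>V. \<forall>j\<in>V. \<exists>s \<le> card V - 1. \<exists>p :: nat \<Rightarrow> 'v.
       p 0 = i \<and> p s = j \<and> (\<forall>l\<in>{0..s}. p l \<in> V) \<and> (\<forall>l\<in>{1..s}. (p (l - 1), p l) \<in> E))"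

definition jointly_strongly_conn :: "nat \<Rightarrow> (nat \<Rightarrow> ereal^'n^'n) \<Rightarrow> bool" where
  "jointly_strongly_conn m A \<longleftrightarrow> strongly_conn (UNIV :: 'n set) (\<Union>r\<in>{1..m}. dep_edges (A r))"

text \<open>
  \<open>trajectory B x0 r\<close> is \<open>x(r)\<close>, where \<open>x(0) = x0\<close> and \<open>x(r) = B r \<otimes> x(r-1)\<close> for \<open>r \<ge> 1\<close>;
  \<open>B 0\<close> is never used.
\<close>

primrec trajectory :: "(nat \<Rightarrow> ereal^'n^'n) \<Rightarrow> real^'n \<Rightarrow> nat \<Rightarrow> ereal^'n" where
  "trajectory B x0 0 = (\<chi> i. ereal (x0 $ i))"
| "trajectory B x0 (Suc r) = B (Suc r) \<otimes>\<^sub>v trajectory B x0 r"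

definition attains_consensus :: "(nat \<Rightarrow> ereal^'n^'n) \<Rightarrow> nat \<Rightarrow> real^'n \<Rightarrow> bool" where
  "attains_consensus B n x0 \<longleftrightarrow> (\<forall>i. trajectory B x0 n $ i = ereal (MAX j. x0 $ j))"

end

theory Submission
  imports Defs
begin

text \<open>
  The entry \<open>x\<^sub>i(r)\<close> is the maximum of \<open>x\<^sub>j(0)\<close> over the nodes \<open>j\<close> from which a walk leads to
  \<open>i\<close> whose \<open>l\<close>-th step is an edge of the graph of the \<open>l\<close>-th matrix. Hence consensus for all
  initial conditions means that such walks join every pair of nodes, and they live in the union
  graph. Conversely, all nodes carry loops, so during one round through \<open>A\<^sub>1, ..., A\<^sub>m\<close> any edge of
  the union graph can be traversed, and \<open>N\<close> rounds suffice.
\<close>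

text \<open>For adjacency matrices this is the edge set of the dependency graph of the tropical
  product of \<open>B r\<close>, ..., \<open>B 1\<close>, the latest factor on the left. Pairs run
  from source to target, so a new step composes on the right.\<close>

primrec timed_walks :: "(nat \<Rightarrow> ereal^'n^'n) \<Rightarrow> nat \<Rightarrow> ('n \<times> 'n) set" where
  "timed_walks B 0 = Id"
| "timed_walks B (Suc r) = timed_walks B r O dep_edges (B (Suc r))"

text \<open>An entry 0 passes a value on unchanged and an entry -\<infinity> blocks it, so each time
  step extends the walks by one edge. The maximum is split into an attained value and an upper
  bound; the attained part also keeps all entries finite, which the induction needs.\<close>

lemma trajectory_timed_walks:
  fixes B :: "nat \<Rightarrow> ereal^'n^'n"
  assumes "\<And>r. r \<in> {1..n} \<Longrightarrow> trop_adjacency (B r)"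
  shows "(\<exists>j. (j, i) \<in> timed_walks B n \<and> trajectory B x0 n $ i = ereal (x0 $ j)) \<and>
         (\<forall>j. (j, i) \<in> timed_walks B n \<longrightarrow> ereal (x0 $ j) \<le> trajectory B x0 n $ i)"
  using assms
proof (induction n arbitrary: i)
  case 0
  then show ?case by simp
next
  case (Suc n)
  let ?B = "B (Suc n)" and ?x = "trajectory B x0 n"
  have IH: "\<exists>j. (j, i) \<in> timed_walks B n \<and> ?x $ i = ereal (x0 $ j)"
      "\<And>j. (j, i) \<in> timed_walks B n \<Longrightarrow> ereal (x0 $ j) \<le> ?x $ i" for i
    using Suc by auto
  have adj: "?B $ a $ b \<in> {0, -\<infinity>}" "?B $ a $ a = 0" for a b
    using Suc.prems[of "Suc n"] by (auto simp: trop_adjacency_def)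
  have fin: "?x $ a \<noteq> -\<infinity>" for a
    using IH(1)[of a] by auto
  have max: "trajectory B x0 (Suc n) $ i = Max (range (\<lambda>j. ?B $ i $ j + ?x $ j))"
    by (simp add: trop_mult_vec_def)
  then have ge: "?B $ i $ j + ?x $ j \<le> trajectory B x0 (Suc n) $ i" for j
    by simp
  have "trajectory B x0 (Suc n) $ i \<in> range (\<lambda>j. ?B $ i $ j + ?x $ j)"
    unfolding max by (rule Max_in) auto
  then obtain b where b: "trajectory B x0 (Suc n) $ i = ?B $ i $ b + ?x $ b"
    by blast
  \<comment> \<open>The loop at \<open>i\<close> already contributes the finite value
    \<open>?x $ i\<close>, so a maximising index cannot sit at an entry -\<infinity>.\<close>
  have "?B $ i $ b = 0"
  proof (rule ccontr)
    assume "?B $ i $ b \<noteq> 0"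
    then have "?B $ i $ b = -\<infinity>" using adj(1)[of i b] by simp
    moreover obtain j where "?x $ b = ereal (x0 $ j)" using IH(1) by blast
    ultimately have "trajectory B x0 (Suc n) $ i = -\<infinity>" using b by simp
    then show False using ge[of i] adj(2)[of i] fin[of i] by simp
  qed
  moreover obtain j where "(j, b) \<in> timed_walks B n" "?x $ b = ereal (x0 $ j)"
    using IH(1) by blast
  ultimately have "(j, i) \<in> timed_walks B (Suc n)"
      "trajectory B x0 (Suc n) $ i = ereal (x0 $ j)"
    using b by (auto simp: dep_edges_def)
  moreover have "ereal (x0 $ j) \<le> trajectory B x0 (Suc n) $ i"
    if "(j, i) \<in> timed_walks B (Suc n)" for j
  proof -
    from that obtain c where "(j, c) \<in> timed_walks B n" "?B $ i $ c = 0"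
      by (auto simp: dep_edges_def)
    then show ?thesis using IH(2)[of j c] ge[of c] by simp
  qed
  ultimately show ?case by blast
qed

lemma attains_consensus_iff_timed_walks:
  fixes B :: "nat \<Rightarrow> ereal^'n^'n"
  assumes "\<And>r. r \<in> {1..n} \<Longrightarrow> trop_adjacency (B r)"
  shows "(\<forall>x0. attains_consensus B n x0) \<longleftrightarrow> timed_walks B n = UNIV"
proof
  assume consensus: "\<forall>x0. attains_consensus B n x0"
  have "(j, i) \<in> timed_walks B n" for i j
  proof -
    \<comment> \<open>This indicator vector has a positive entry only at \<open>j\<close>. Consensus
      at \<open>i\<close> therefore forces the node that supplies the value at \<open>i\<close> to
      be \<open>j\<close> itself.\<close>
    define x0 :: "real^'n" where "x0 = (\<chi> a. if a = j then 1 else 0)"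
    have "1 \<le> (MAX a. x0 $ a)"
      by (rule Max_ge) (auto simp: x0_def image_iff)
    moreover obtain a where "(a, i) \<in> timed_walks B n" "trajectory B x0 n $ i = ereal (x0 $ a)"
      using trajectory_timed_walks[of n B, OF assms] by blast
    moreover from this have "x0 $ a = (MAX a. x0 $ a)"
      using consensus by (simp add: attains_consensus_def)
    ultimately have "1 \<le> x0 $ a" by simp
    then have "a = j" by (simp add: x0_def split: if_splits)
    then show ?thesis using \<open>(a, i) \<in> timed_walks B n\<close> by simp
  qed
  then show "timed_walks B n = UNIV" by auto
next
  assume all: "timed_walks B n = UNIV"
  show "\<forall>x0. attains_consensus B n x0"
    unfolding attains_consensus_def
  proof (intro allI)
    fix x0 :: "real^'n" and i
    obtain j where j: "trajectory B x0 n $ i = ereal (x0 $ j)"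
      using trajectory_timed_walks[of n B, OF assms] by blast
    have "x0 $ a \<le> x0 $ j" for a
      using trajectory_timed_walks[of n B i x0, OF assms] all j by auto
    then have "(MAX a. x0 $ a) = x0 $ j"
      by (intro Max_eqI) auto
    then show "trajectory B x0 n $ i = ereal (MAX a. x0 $ a)"
      using j by simp
  qed
qed

text \<open>The zero diagonal puts a loop at every node, so a walk can wait at its endpoint.\<close>

lemma timed_walks_mono:
  assumes "\<And>r. trop_adjacency (B r)" "a \<le> b"
  shows "timed_walks B a \<subseteq> timed_walks B b"
proof -
  have "timed_walks B r \<subseteq> timed_walks B (Suc r)" for r
    using assms(1)[of "Suc r"] by (auto simp: dep_edges_def trop_adjacency_def)
  then show ?thesis using assms(2) by (rule lift_Suc_mono_le)
qed

lemma timed_walks_subset_rtrancl: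
  assumes "\<And>r. r \<in> {1..n} \<Longrightarrow> dep_edges (B r) \<subseteq> E"
  shows "timed_walks B n \<subseteq> E\<^sup>*"
  using assms
proof (induction n)
  case (Suc n)
  then have "timed_walks B n \<subseteq> E\<^sup>*" "dep_edges (B (Suc n)) \<subseteq> E"
    by auto
  then show ?case by (auto intro: rtrancl_into_rtrancl)
qed auto

lemma union_relpow_subset_timed_walks:
  fixes A :: "nat \<Rightarrow> ereal^'n^'n"
  assumes m: "1 \<le> m" and adj: "\<And>r. r \<in> {1..m} \<Longrightarrow> trop_adjacency (A r)"
  shows "(\<Union>r\<in>{1..m}. dep_edges (A r)) ^^ q \<subseteq> timed_walks (\<lambda>r. A ((r - 1) mod m + 1)) (q * m)"
    (is "?U ^^ q \<subseteq> timed_walks ?B _")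
proof (induction q)
  case (Suc q)
  have adjB: "trop_adjacency (?B r)" for r
    using m by (intro adj) (auto simp: Suc_le_eq)
  have "timed_walks ?B (q * m) O dep_edges (A r) \<subseteq> timed_walks ?B (Suc q * m)"
    if r: "r \<in> {1..m}" for r
  proof -
    obtain t where t: "r = Suc t" "t < m" using r by (cases r) auto
    \<comment> \<open>The walk waits for \<open>t\<close> steps of the new round; the next matrix is
      \<open>A r\<close>, because \<open>(q * m + t) mod m + 1 = r\<close>.\<close>
    have "timed_walks ?B (q * m) O dep_edges (A r)
        \<subseteq> timed_walks ?B (q * m + t) O dep_edges (?B (Suc (q * m + t)))"
      using timed_walks_mono[of ?B "q * m" "q * m + t"] adjB t by fastforce
    also have "\<dots> = timed_walks ?B (Suc (q * m + t))" by simp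
    also have "\<dots> \<subseteq> timed_walks ?B (Suc q * m)"
      using t by (intro timed_walks_mono adjB) simp
    finally show ?thesis .
  qed
  then have "timed_walks ?B (q * m) O ?U \<subseteq> timed_walks ?B (Suc q * m)" by blast
  then show ?case using Suc.IH by (auto simp del: timed_walks.simps)
qed simp

text \<open>The length bound in \<open>strongly_conn\<close> excludes no reachable pair: a shortest
  walk of length \<open>s\<close> visits \<open>s + 1\<close> distinct nodes.\<close>

lemma strongly_conn_UNIV_iff_rtrancl:
  fixes E :: "('n::finite \<times> 'n) set"
  shows "strongly_conn UNIV E \<longleftrightarrow> E\<^sup>* = UNIV"
proof
  have path: "(p 0, p s) \<in> E ^^ s" if "\<forall>l\<in>{1..s}. (p (l - 1), p l) \<in> E" for p :: "nat \<Rightarrow> 'n" and s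
    unfolding relpow_fun_conv using that by (intro exI[of _ p]) force
  assume "strongly_conn UNIV E"
  then have "(i, j) \<in> E\<^sup>*" for i j
    unfolding strongly_conn_def by (metis UNIV_I path relpow_imp_rtrancl)
  then show "E\<^sup>* = UNIV" by auto
next
  assume all: "E\<^sup>* = UNIV"
  show "strongly_conn UNIV E"
    unfolding strongly_conn_def
  proof (intro ballI)
    fix i j
    define s where "s = (LEAST s. (i, j) \<in> E ^^ s)"
    have "\<exists>s. (i, j) \<in> E ^^ s"
      using all rtrancl_imp_relpow by (metis UNIV_I)
    then have "(i, j) \<in> E ^^ s"
      unfolding s_def by (rule LeastI_ex)
    then obtain p where p: "p 0 = i" "p s = j" "\<And>l. l < s \<Longrightarrow> (p l, p (Suc l)) \<in> E"
      by (auto simp: relpow_fun_conv)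
    have sub: "(p a, p b) \<in> E ^^ (b - a)" if "a \<le> b" "b \<le> s" for a b
      unfolding relpow_fun_conv using that p(3) by (intro exI[of _ "\<lambda>l. p (a + l)"]) auto
    \<comment> \<open>A shortest walk repeats no node, as the part between two visits could be cut out.\<close>
    have "p a \<noteq> p b" if "a < b" "b \<le> s" for a b
    proof
      assume "p a = p b"
      then have "(i, j) \<in> E ^^ a O E ^^ (s - b)"
        using sub[of 0 a] sub[of b s] that p by auto
      then have "(i, j) \<in> E ^^ (a + (s - b))"
        by (simp add: relpow_add)
      then have "s \<le> a + (s - b)"
        unfolding s_def by (rule Least_le)
      then show False using that by simp
    qed
    then have "inj_on p {0..s}"
      by (auto intro!: linorder_inj_onI)
    then have "card {0..s} \<le> CARD('n)"
      by (rule card_inj_on_le) auto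
    then have "s \<le> CARD('n) - 1" by simp
    moreover have "(p (l - 1), p l) \<in> E" if "l \<in> {1..s}" for l
      using that p(3)[of "l - 1"] by (cases l) auto
    ultimately show "\<exists>s\<le>CARD('n) - 1. \<exists>p. p 0 = i \<and> p s = j \<and> (\<forall>l\<in>{0..s}. p l \<in> UNIV) \<and>
        (\<forall>l\<in>{1..s}. (p (l - 1), p l) \<in> E)"
      using p(1,2) by (intro exI[of _ s] conjI exI[of _ p]) auto
  qed
qed

text \<open>A length bound common to all pairs lets one number of rounds serve every pair at
  once.\<close>

lemma strongly_conn_UNIV_relpow:
  fixes E :: "('n::finite \<times> 'n) set"
  assumes "strongly_conn UNIV E"
  shows "\<exists>s\<le>CARD('n). (i, j) \<in> E ^^ s"
proof -
  from assms obtain s p where "s \<le> CARD('n) - 1" "p 0 = i" "p s = j"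
      "\<forall>l\<in>{1..s}. (p (l - 1), p l) \<in> E"
    unfolding strongly_conn_def by blast
  then have "s \<le> CARD('n)" "\<forall>l<s. (p l, p (Suc l)) \<in> E"
    by force+
  with \<open>p 0 = i\<close> \<open>p s = j\<close> show ?thesis
    unfolding relpow_fun_conv by blast
qed

theorem theorem5p4:
  fixes A :: "nat \<Rightarrow> ereal^'n^'n" and m :: nat
  assumes "1 \<le> m"
    and "\<And>r. r \<in> {1..m} \<Longrightarrow> trop_adjacency (A r)"
  shows "(\<exists>n\<ge>1. \<exists>k :: nat \<Rightarrow> nat. (\<forall>r\<in>{1..n}. 1 \<le> k r \<and> k r \<le> m) \<and>
            (\<forall>x0 :: real^'n. attains_consensus (\<lambda>r. A (k r)) n x0))
         \<longleftrightarrow> jointly_strongly_conn m A"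
    (is "?lhs \<longleftrightarrow> _")
proof
  let ?U = "\<Union>r\<in>{1..m}. dep_edges (A r)"
  {
    assume ?lhs
    then obtain n k where "\<forall>r\<in>{1..n}. 1 \<le> k r \<and> k r \<le> m"
      and consensus: "\<forall>x0 :: real^'n. attains_consensus (\<lambda>r. A (k r)) n x0"
      by blast
    then have k: "k r \<in> {1..m}" if "r \<in> {1..n}" for r
      using that by simp
    with consensus have "timed_walks (\<lambda>r. A (k r)) n = UNIV"
      using attains_consensus_iff_timed_walks[of n "\<lambda>r. A (k r)"] assms(2) by blast
    moreover have "timed_walks (\<lambda>r. A (k r)) n \<subseteq> ?U\<^sup>*"
      by (rule timed_walks_subset_rtrancl) (use k in blast)
    ultimately show "jointly_strongly_conn m A"
      unfolding jointly_strongly_conn_def strongly_conn_UNIV_iff_rtrancl by blast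
  next
    assume "jointly_strongly_conn m A"
    then have conn: "strongly_conn UNIV ?U"
      by (simp add: jointly_strongly_conn_def)
    define k where "k r = (r - 1) mod m + 1" for r
    have k: "1 \<le> k r \<and> k r \<le> m" for r
      using assms(1) by (simp add: k_def Suc_le_eq)
    then have adj: "trop_adjacency (A (k r))" for r
      by (intro assms(2)) simp
    \<comment> \<open>One round more than the \<open>CARD('n) - 1\<close> that the walks require
      keeps the sequence nonempty even for a single node.\<close>
    let ?n = "CARD('n) * m"
    have "(i, j) \<in> timed_walks (\<lambda>r. A (k r)) ?n" for i j
    proof -
      obtain s where s: "s \<le> CARD('n)" "(i, j) \<in> ?U ^^ s"
        using strongly_conn_UNIV_relpow[OF conn] by blast
      then have "(i, j) \<in> timed_walks (\<lambda>r. A (k r)) (s * m)"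
        using union_relpow_subset_timed_walks[of m A s, OF assms] unfolding k_def by blast
      \<comment> \<open>Walks that arrive after \<open>s\<close> rounds wait for the remaining
        ones.\<close>
      then show ?thesis
        using timed_walks_mono[of "\<lambda>r. A (k r)" "s * m" ?n, OF adj] s(1) by auto
    qed
    then have "timed_walks (\<lambda>r. A (k r)) ?n = UNIV"
      by auto
    then have "\<forall>x0. attains_consensus (\<lambda>r. A (k r)) ?n x0"
      using attains_consensus_iff_timed_walks[of ?n "\<lambda>r. A (k r)"] adj by blast
    moreover have "1 \<le> ?n"
      using assms(1) by (simp add: Suc_le_eq)
    ultimately show ?lhs using k by blast
  }
qed

end
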